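(* Let $p>3$ be a prime. Then for each $r\in\mathbb{N}$ there is a $p$-adic integer $c_r$, depending only on $r$, such that $$\sum_{k=0}^{p-1}(2k+1)^{2r+1}A_k\equiv c_r\, p \pmod {p^3}.$$
   Context: $A_n=\sum_{k=0}^{n}\binom{n}{k}^2\binom{n+k}{k}^2$ are the Apéry numbers; $\mathbb{N}=\{0,1,2,\dots\}$. *)

theory Defs
  imports Complex_Main "HOL-Algebra.Ring" "HOL-Number_Theory.Cong" "HOL-Computational_Algebra.Primes"
begin

definition apery :: "nat \<Rightarrow> nat" where
  "apery n = (\<Sum>k\<le>n. (n choose k)\<^sup>2 * ((n + k) choose k)\<^sup>2)"

text \<open>
  The ring of $p$-adic integers as the inverse limit of the rings of residues modulo $p^n$:
  an element is a coherent sequence whose $n$-th entry is the canonical representative of the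
  residue class modulo $p^n$.
\<close>

definition padic_int_ring :: "nat \<Rightarrow> (nat \<Rightarrow> int) ring" where
  "padic_int_ring p =
    \<lparr>carrier = {x. \<forall>n. 0 \<le> x n \<and> x n < int p ^ n \<and> x (Suc n) mod int p ^ n = x n},
     monoid.mult = (\<lambda>x y n. (x n * y n) mod int p ^ n),
     one = (\<lambda>n. 1 mod int p ^ n),
     zero = (\<lambda>n. 0),
     add = (\<lambda>x y n. (x n + y n) mod int p ^ n)\<rparr>"

definition padic_of_int :: "nat \<Rightarrow> int \<Rightarrow> nat \<Rightarrow> int" where
  "padic_of_int p a = (\<lambda>n. a mod int p ^ n)"

text \<open>
  \<open>padic_eq_rat p x q\<close> says that the $p$-adic integer \<open>x\<close> equals the rational number \<open>q\<close> (an
  equation in the field of $p$-adic numbers, here with denominators cleared).  So \<open>q\<close> is a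
  $p$-adic integer iff such an \<open>x\<close> exists.
\<close>

definition padic_eq_rat :: "nat \<Rightarrow> (nat \<Rightarrow> int) \<Rightarrow> rat \<Rightarrow> bool" where
  "padic_eq_rat p x q \<longleftrightarrow>
    x \<in> carrier (padic_int_ring p) \<and>
    padic_of_int p (snd (quotient_of q)) \<otimes>\<^bsub>padic_int_ring p\<^esub> x
      = padic_of_int p (fst (quotient_of q))"

definition padic_cong :: "nat \<Rightarrow> (nat \<Rightarrow> int) \<Rightarrow> (nat \<Rightarrow> int) \<Rightarrow> int \<Rightarrow> bool" where
  "padic_cong p x y m \<longleftrightarrow>
    (\<exists>z \<in> carrier (padic_int_ring p).
      x = y \<oplus>\<^bsub>padic_int_ring p\<^esub> (padic_of_int p m \<otimes>\<^bsub>padic_int_ring p\<^esub> z))"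

lemma padic_of_int_closed:
  assumes "p > 0"
  shows "padic_of_int p a \<in> carrier (padic_int_ring p)"
  using assms by (auto simp: padic_of_int_def padic_int_ring_def mod_mod_cancel)

lemma padic_coherent_op:
  fixes p :: nat and x y :: "nat \<Rightarrow> int"
  assumes "x (Suc n) mod int p ^ n = x n" "y (Suc n) mod int p ^ n = y n"
  shows "(x (Suc n) + y (Suc n)) mod int p ^ Suc n mod int p ^ n = (x n + y n) mod int p ^ n"
    and "(x (Suc n) * y (Suc n)) mod int p ^ Suc n mod int p ^ n = (x n * y n) mod int p ^ n"
proof -
  have d: "int p ^ n dvd int p ^ Suc n" by simp
  show "(x (Suc n) + y (Suc n)) mod int p ^ Suc n mod int p ^ n = (x n + y n) mod int p ^ n"
    unfolding mod_mod_cancel[OF d] using assms by (metis mod_add_eq)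
  show "(x (Suc n) * y (Suc n)) mod int p ^ Suc n mod int p ^ n = (x n * y n) mod int p ^ n"
    unfolding mod_mod_cancel[OF d] using assms by (metis mod_mult_eq)
qed

lemma cring_padic_int_ring:
  assumes "p > 0"
  shows "cring (padic_int_ring p)"
proof (rule cringI)
  show "abelian_group (padic_int_ring p)"
  proof (rule abelian_groupI)
    fix x assume x: "x \<in> carrier (padic_int_ring p)"
    let ?y = "\<lambda>n. (- x n) mod int p ^ n"
    have "?y (Suc n) mod int p ^ n = ?y n" for n
    proof -
      have "?y (Suc n) mod int p ^ n = (- x (Suc n)) mod int p ^ n"
        by (simp add: mod_mod_cancel)
      also have "\<dots> = (- (x (Suc n) mod int p ^ n)) mod int p ^ n"
        by (simp add: mod_minus_eq)
      also have "\<dots> = ?y n" using x by (simp add: padic_int_ring_def)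
      finally show ?thesis .
    qed
    then have "?y \<in> carrier (padic_int_ring p)"
      using assms by (simp add: padic_int_ring_def)
    moreover have "?y \<oplus>\<^bsub>padic_int_ring p\<^esub> x = \<zero>\<^bsub>padic_int_ring p\<^esub>"
      by (simp add: padic_int_ring_def mod_simps)
    ultimately show "\<exists>y\<in>carrier (padic_int_ring p).
        y \<oplus>\<^bsub>padic_int_ring p\<^esub> x = \<zero>\<^bsub>padic_int_ring p\<^esub>" by blast
  qed (use assms in \<open>auto simp: padic_int_ring_def padic_coherent_op mod_simps ac_simps
         fun_eq_iff simp del: power_Suc\<close>)
  have "\<one>\<^bsub>padic_int_ring p\<^esub> = padic_of_int p 1"
    by (simp add: padic_int_ring_def padic_of_int_def)
  then have one: "\<one>\<^bsub>padic_int_ring p\<^esub> \<in> carrier (padic_int_ring p)"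
    using padic_of_int_closed[OF assms] by simp
  show "comm_monoid (padic_int_ring p)"
    by (rule comm_monoidI)
       (use assms one in \<open>auto simp: padic_int_ring_def padic_coherent_op mod_simps ac_simps
         fun_eq_iff simp del: power_Suc\<close>)
qed (auto simp: padic_int_ring_def mod_simps distrib_right)

end

theory Submission
  imports Defs "HOL-Computational_Algebra.Polynomial"
begin

text \<open>
  Apery's recurrence and summation by parts show that \<open>p ^ 3\<close> divides the sum of
  \<open>L f (k) * apery k\<close> over \<open>k < p\<close>, where \<open>L\<close> is the adjoint of the recurrence operator.
  In the variable \<open>x = 2 * k + 1\<close>, \<open>L\<close> maps the even monomial \<open>x ^ (2 * m)\<close> to an odd polynomial
  of degree \<open>2 * m + 3\<close> with leading coefficient \<open>- 4\<close>. So, up to powers of \<open>2\<close> and independently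
  of \<open>p\<close>, every odd moment reduces modulo \<open>p ^ 3\<close> to the first one. With
  \<open>t j = (p - 1 choose j) * (p + j choose j)\<close>, the first moment is the sum of
  \<open>p\<^sup>2 * (t j)\<^sup>2 / (2 * j + 1)\<close> over \<open>j < p\<close>, and \<open>t j\<close> is \<open>(- 1) ^ j\<close> modulo \<open>p\<^sup>2\<close>. The term
  with \<open>2 * j + 1 = p\<close> contributes \<open>p\<close> modulo \<open>p ^ 3\<close>, and the others cancel in the pairs \<open>j\<close>,
  \<open>p - 1 - j\<close>.
\<close>

section \<open>Summands of the Apery numbers\<close>

definition apery_term :: "nat \<Rightarrow> nat \<Rightarrow> int" where
  "apery_term n k = int ((n choose k) * ((n + k) choose k))"

lemma apery_term_eq_0: "n < k \<Longrightarrow> apery_term n k = 0"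
  by (simp add: apery_term_def)

lemma apery_term_0_right [simp]: "apery_term n 0 = 1"
  by (simp add: apery_term_def)

text \<open>Terms with \<open>k > n\<close> vanish, so sums for different \<open>n\<close> can share
  one range.\<close>

lemma apery_conv_apery_term:
  assumes "n < N"
  shows "int (apery n) = (\<Sum>k<N. (apery_term n k)\<^sup>2)"
proof -
  have "int (apery n) = (\<Sum>k\<le>n. (apery_term n k)\<^sup>2)"
    by (simp add: apery_def apery_term_def power_mult_distrib)
  also have "\<dots> = (\<Sum>k<N. (apery_term n k)\<^sup>2)"
    by (rule sum.mono_neutral_left) (use assms in \<open>auto simp: apery_term_eq_0\<close>)
  finally show ?thesis .
qed

lemma apery_term_fact:
  assumes "k \<le> n"
  shows "real_of_int (apery_term n k) = fact (n + k) / ((fact k)\<^sup>2 * fact (n - k))"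
  using assms by (simp add: apery_term_def binomial_fact power2_eq_square)

text \<open>A ratio of factorials with denominators cleared; for \<open>k > n\<close> both sides
  vanish.\<close>

lemma apery_term_Suc_left:
  "(int n + 1 - int k) * apery_term (Suc n) k = (int n + 1 + int k) * apery_term n k"
proof (cases "k \<le> n")
  case True
  then obtain d where n: "n = k + d"
    using le_Suc_ex by blast
  have "real_of_int ((int n + 1 - int k) * apery_term (Suc n) k)
      = real_of_int ((int n + 1 + int k) * apery_term n k)"
    by (simp add: apery_term_fact n Suc_diff_le divide_simps) (simp add: algebra_simps)
  then show ?thesis by linarith
next
  case False
  then show ?thesis by (cases "k = Suc n") (simp_all add: apery_term_eq_0)
qed

lemma apery_term_Suc_right:
  "(int k + 1)\<^sup>2 * apery_term n (Suc k) = (int n + int k + 1) * (int n - int k) * apery_term n k"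
proof (cases "k < n")
  case True
  then obtain d where n: "n = Suc (k + d)"
    using less_imp_Suc_add by blast
  have "real_of_int ((int k + 1)\<^sup>2 * apery_term n (Suc k))
      = real_of_int ((int n + int k + 1) * (int n - int k) * apery_term n k)"
    by (simp add: apery_term_fact n divide_simps power2_eq_square add_eq_0_iff)
       (simp add: algebra_simps)
  then show ?thesis by linarith
next
  case False
  then show ?thesis by (cases "k = n") (simp_all add: apery_term_eq_0)
qed

section \<open>Apery's recurrence by creative telescoping\<close>

text \<open>
  The common factor \<open>w\<close> turns the creative telescoping identity below into a polynomial identity
  that also covers the boundary cases \<^term>\<open>k = n\<close> and \<^term>\<open>k = n + 1\<close>.
\<close>

lemma apery_term_common_factor:
  assumes "k \<le> Suc n"
  obtains w :: real where
    "apery_term (Suc (Suc n)) (Suc k) = w * (real n + real k + 2) * (real n + real k + 3)"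
    "apery_term (Suc n) (Suc k) = w * (real n + real k + 2) * (real n - real k + 1)"
    "apery_term n (Suc k) = w * (real n - real k + 1) * (real n - real k)"
    "apery_term (Suc n) k = w * (real k + 1)\<^sup>2"
proof
  \<comment> \<open>The part shared by the four factorial quotients; \<open>k \<le> Suc n\<close>
    keeps \<open>Suc n - k\<close> exact.\<close>
  let ?w = "fact (Suc (n + k)) / ((fact (Suc k))\<^sup>2 * fact (Suc n - k)) :: real"
  show "apery_term (Suc (Suc n)) (Suc k) = ?w * (real n + real k + 2) * (real n + real k + 3)"
    using assms by (simp add: apery_term_fact algebra_simps)
  show "apery_term (Suc n) k = ?w * (real k + 1)\<^sup>2"
    using assms
    by (simp add: apery_term_fact divide_simps power_mult_distrib add_eq_0_iff add.commute)
  show "apery_term (Suc n) (Suc k) = ?w * (real n + real k + 2) * (real n - real k + 1)"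
  proof (cases "k = Suc n")
    case False
    then obtain d where n: "n = k + d"
      using assms le_Suc_eq nat_le_iff_add by auto
    show ?thesis
      by (simp add: apery_term_fact n Suc_diff_le divide_simps) (simp add: algebra_simps)
  qed (simp add: apery_term_eq_0)
  show "apery_term n (Suc k) = ?w * (real n - real k + 1) * (real n - real k)"
  proof (cases "k < n")
    case True
    then obtain d where n: "n = Suc (k + d)"
      using less_imp_Suc_add by blast
    have "Suc (Suc (k + d)) - k = Suc (Suc d)" by simp
    then show ?thesis
      by (simp add: apery_term_fact n divide_simps add_eq_0_iff)
  next
    case False
    then have "k = n \<or> k = Suc n" using assms by auto
    then show ?thesis by (auto simp: apery_term_eq_0)
  qed
qed

text \<open>The certificate is the one found by Zagier for Apery's recurrence.\<close>

definition apery_cert :: "nat \<Rightarrow> nat \<Rightarrow> int" where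
  "apery_cert n k =
    4 * (2 * int n + 1) * (int k * (2 * int k + 1) - (2 * int n + 1)\<^sup>2) * (apery_term n k)\<^sup>2"

text \<open>The middle index is \<open>n + 1\<close>. Taking three values rather than a function
  lets the operator act on single summands and on whole sums alike.\<close>

definition apery_op :: "nat \<Rightarrow> int \<Rightarrow> int \<Rightarrow> int \<Rightarrow> int" where
  "apery_op n a b c = (int n + 2) ^ 3 * a
    - (2 * int n + 3) * (17 * (int n + 1)\<^sup>2 + 17 * (int n + 1) + 5) * b + (int n + 1) ^ 3 * c"

lemma apery_cert_0:
  "apery_op n ((apery_term (Suc (Suc n)) 0)\<^sup>2) ((apery_term (Suc n) 0)\<^sup>2) ((apery_term n 0)\<^sup>2)
    = apery_cert (Suc n) 0"
  by (simp add: apery_op_def apery_cert_def algebra_simps power2_eq_square power3_eq_cube)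

text \<open>Both sides are \<open>w\<^sup>2\<close> times polynomials in \<open>n\<close> and
  \<open>k\<close>, and these agree.\<close>

lemma apery_cert_Suc:
  assumes "k \<le> Suc n"
  shows "apery_op n ((apery_term (Suc (Suc n)) (Suc k))\<^sup>2) ((apery_term (Suc n) (Suc k))\<^sup>2)
      ((apery_term n (Suc k))\<^sup>2) = apery_cert (Suc n) (Suc k) - apery_cert (Suc n) k"
proof -
  obtain w :: real where w:
    "apery_term (Suc (Suc n)) (Suc k) = w * (real n + real k + 2) * (real n + real k + 3)"
    "apery_term (Suc n) (Suc k) = w * (real n + real k + 2) * (real n - real k + 1)"
    "apery_term n (Suc k) = w * (real n - real k + 1) * (real n - real k)"
    "apery_term (Suc n) k = w * (real k + 1)\<^sup>2"
    using apery_term_common_factor[OF assms] by blast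
  have "real_of_int (apery_op n ((apery_term (Suc (Suc n)) (Suc k))\<^sup>2)
      ((apery_term (Suc n) (Suc k))\<^sup>2) ((apery_term n (Suc k))\<^sup>2))
    = real_of_int (apery_cert (Suc n) (Suc k) - apery_cert (Suc n) k)"
    unfolding apery_op_def apery_cert_def of_int_add of_int_diff of_int_mult of_int_power w
      of_int_of_nat_eq of_nat_Suc of_int_numeral of_int_1
    by (simp add: algebra_simps power2_eq_square power3_eq_cube)
  then show ?thesis by linarith
qed

text \<open>The certificates telescope over \<open>k \<le> n + 2\<close>; the last one contains
  \<open>apery_term (Suc n) (Suc (Suc n))\<close>, which is zero.\<close>

lemma apery_recurrence_Suc:
  "apery_op n (int (apery (Suc (Suc n)))) (int (apery (Suc n))) (int (apery n)) = 0"
proof -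
  let ?t = apery_term
  have partial: "(\<Sum>k<Suc m. apery_op n ((?t (Suc (Suc n)) k)\<^sup>2) ((?t (Suc n) k)\<^sup>2) ((?t n k)\<^sup>2))
      = apery_cert (Suc n) m" if "m \<le> Suc (Suc n)" for m
    using that
  proof (induction m)
    case 0
    then show ?case using apery_cert_0[of n] by simp
  next
    case (Suc m)
    then show ?case using apery_cert_Suc[of m n] by simp
  qed
  have "apery_op n (int (apery (Suc (Suc n)))) (int (apery (Suc n))) (int (apery n))
      = (\<Sum>k<Suc (Suc (Suc n)). apery_op n ((?t (Suc (Suc n)) k)\<^sup>2) ((?t (Suc n) k)\<^sup>2) ((?t n k)\<^sup>2))"
    by (subst (1 2 3) apery_conv_apery_term[where N = "Suc (Suc (Suc n))"])
       (simp_all only: apery_op_def sum.distrib sum_subtractf sum_distrib_left lessI less_SucI)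
  also have "\<dots> = 0"
    by (subst partial) (simp_all add: apery_cert_def apery_term_eq_0)
  finally show ?thesis .
qed

text \<open>At \<open>n = 0\<close> the truncated index \<open>n - 1\<close> is harmless, its
  coefficient being zero.\<close>

lemma apery_recurrence:
  "(int n + 1) ^ 3 * int (apery (Suc n)) + int n ^ 3 * int (apery (n - 1))
    = (2 * int n + 1) * (17 * (int n)\<^sup>2 + 17 * int n + 5) * int (apery n)"
proof (cases n)
  case 0
  then show ?thesis by (simp add: apery_def)
next
  case (Suc m)
  then show ?thesis using apery_recurrence_Suc[of m]
    by (simp add: apery_op_def algebra_simps)
qed

section \<open>Reduction of odd moments to the first one\<close>

text \<open>Summation by parts, moving the recurrence operator from the Apery numbers onto \<open>f\<close>.\<close>

lemma sum_apery_adjoint: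
  fixes f :: "int \<Rightarrow> int"
  shows "(\<Sum>n<N. (int n ^ 3 * f (int n - 1) + (int n + 1) ^ 3 * f (int n + 1)
        - (2 * int n + 1) * (17 * (int n)\<^sup>2 + 17 * int n + 5) * f (int n)) * int (apery n))
    = int N ^ 3 * (f (int N) * int (apery (N - 1)) - f (int N - 1) * int (apery N))"
proof (induction N)
  case (Suc N)
  \<comment> \<open>The recurrence at \<open>N\<close>, multiplied by \<open>f N\<close>, leaves
    only the new boundary term.\<close>
  have "f (int N) * ((int N + 1) ^ 3 * int (apery (Suc N)) + int N ^ 3 * int (apery (N - 1)))
      = f (int N) * ((2 * int N + 1) * (17 * (int N)\<^sup>2 + 17 * int N + 5) * int (apery N))"
    by (simp only: apery_recurrence)
  then show ?case
    unfolding sum.lessThan_Suc Suc.IH by (simp add: algebra_simps)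
qed simp

definition apery_sum :: "nat \<Rightarrow> int poly \<Rightarrow> int" where
  "apery_sum N P = (\<Sum>k<N. poly P (2 * int k + 1) * int (apery k))"

lemma apery_sum_add: "apery_sum N (P + Q) = apery_sum N P + apery_sum N Q"
  by (simp add: apery_sum_def sum.distrib ring_distribs)

lemma apery_sum_smult: "apery_sum N (smult c P) = c * apery_sum N P"
  by (simp add: apery_sum_def sum_distrib_left mult.assoc)

definition poly_refl :: "int poly \<Rightarrow> int poly" where
  "poly_refl P = pcompose P [:0, -1:]"

lemma poly_poly_refl [simp]: "poly (poly_refl P) x = poly P (- x)"
  by (simp add: poly_refl_def poly_pcompose)

lemma coeff_poly_refl: "coeff (poly_refl P) i = (-1) ^ i * coeff P i"
  unfolding poly_refl_def by (simp add: coeff_pcompose_linear)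

definition odd_poly :: "int poly \<Rightarrow> bool" where
  "odd_poly P \<longleftrightarrow> (\<forall>i. even i \<longrightarrow> coeff P i = 0)"

text \<open>With \<^term>\<open>x = 2 * n + 1\<close>, this is eight times the adjoint operator applied to \<open>x ^ (2 * m)\<close>.\<close>

definition red_poly :: "nat \<Rightarrow> int poly" where
  "red_poly m = (let F = [:1, 1:] ^ 3 * [:2, 1:] ^ (2 * m) in
    F - poly_refl F - monom 34 (2 * m + 3) - monom 6 (2 * m + 1))"

text \<open>\<open>F - poly_refl F\<close> keeps only odd powers, and both subtracted monomials are
  odd.\<close>

lemma odd_poly_red_poly: "odd_poly (red_poly m)"
  by (simp add: odd_poly_def red_poly_def Let_def coeff_poly_refl, presburger)

text \<open>\<open>F\<close> is monic of odd degree, so \<open>F - poly_refl F\<close> contributes 2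
  and the total is 2 - 34: up to sign a power of two, hence invertible modulo odd primes.\<close>

lemma
  shows degree_red_poly: "degree (red_poly m) \<le> 2 * m + 3"
    and coeff_red_poly: "coeff (red_poly m) (2 * m + 3) = - 32"
proof -
  define F :: "int poly" where "F = [:1, 1:] ^ 3 * [:2, 1:] ^ (2 * m)"
  have deg: "degree F = 2 * m + 3"
    unfolding F_def by (simp add: degree_mult_eq degree_power_eq)
  have "lead_coeff F = 1"
    unfolding F_def by (simp only: lead_coeff_mult lead_coeff_power) simp
  then have lead: "coeff F (2 * m + 3) = 1"
    by (simp add: deg)
  have red: "red_poly m = F - poly_refl F - monom 34 (2 * m + 3) - monom 6 (2 * m + 1)"
    by (simp only: red_poly_def F_def Let_def)
  show "coeff (red_poly m) (2 * m + 3) = - 32"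
    by (simp add: red coeff_poly_refl lead)
  show "degree (red_poly m) \<le> 2 * m + 3"
    by (rule degree_le) (auto simp: red coeff_poly_refl deg coeff_eq_0)
qed

text \<open>Summation by parts leaves only a boundary term, which has the factor
  \<open>N ^ 3\<close>.\<close>

lemma apery_sum_red_poly: "int N ^ 3 dvd apery_sum N (red_poly m)"
proof -
  define f :: "int \<Rightarrow> int" where "f n = (2 * n + 1) ^ (2 * m)" for n
  have "poly (red_poly m) (2 * int n + 1) = 8 * (int n ^ 3 * f (int n - 1) + (int n + 1) ^ 3 * f (int n + 1)
        - (2 * int n + 1) * (17 * (int n)\<^sup>2 + 17 * int n + 5) * f (int n))" for n
  proof -
    define x y z where "x = (2 * int n + 1) ^ (2 * m)" "y = (2 * int n + 3) ^ (2 * m)"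
      "z = (2 * int n - 1) ^ (2 * m)"
    \<comment> \<open>Evaluating \<open>poly_refl F\<close> at \<open>2 * n + 1\<close> produces
      this power; the even exponent turns its base into \<open>2 * n - 1\<close>, the value of
      \<open>x\<close> at \<open>n - 1\<close>.\<close>
    have "(1 - 2 * int n) ^ (2 * m) = z"
      unfolding x_y_z_def by (metis even_mult_iff even_two_times_div_two minus_diff_eq dvd_triv_left power_minus_even)
    then have "poly (red_poly m) (2 * int n + 1) = (2 * int n + 2) ^ 3 * y - (- 2 * int n) ^ 3 * z
      - 34 * ((2 * int n + 1) ^ 3 * x) - 6 * ((2 * int n + 1) * x)"
      by (simp add: red_poly_def Let_def poly_monom x_y_z_def power_add algebra_simps)
    moreover have "f (int n) = x" "f (int n + 1) = y" "f (int n - 1) = z"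
      by (simp_all add: f_def x_y_z_def algebra_simps)
    ultimately show ?thesis
      by (simp add: algebra_simps power2_eq_square power3_eq_cube)
  qed
  then have "apery_sum N (red_poly m) = 8 * (int N ^ 3 * (f (int N) * int (apery (N - 1)) - f (int N - 1) * int (apery N)))"
    unfolding apery_sum_def sum_apery_adjoint[symmetric] by (simp only: sum_distrib_left mult.assoc)
  then show ?thesis by simp
qed

text \<open>The quantifier order matters: \<open>a\<close> and \<open>e\<close> serve all
  \<open>N\<close>, which makes the final constant independent of the prime. Induction on the degree
  strips leading terms.\<close>

lemma odd_poly_apery_sum:
  assumes "odd_poly P"
  shows "\<exists>a e. \<forall>N. [2 ^ e * apery_sum N P = a * apery_sum N [:0, 1:]] (mod int N ^ 3)"
  using assms
proof (induction "degree P" arbitrary: P rule: less_induct)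
  case less
  show ?case
  proof (cases "degree P \<le> 1")
    case True
    have "P = smult (coeff P 1) [:0, 1:]"
    proof (rule poly_eqI)
      fix i :: nat
      have "i = 0 \<or> i = 1 \<or> i > 1" by linarith
      then show "coeff P i = coeff (smult (coeff P 1) [:0, 1:]) i"
        using less.prems True by (elim disjE) (auto simp: odd_poly_def coeff_eq_0 coeff_pCons split: nat.splits)
    qed
    then have "apery_sum N P = coeff P 1 * apery_sum N [:0, 1:]" for N
      by (metis apery_sum_smult)
    then show ?thesis by (intro exI[of _ "coeff P 1"] exI[of _ 0]) simp
  next
    case False
    then have "coeff P (degree P) \<noteq> 0" by auto
    then have "odd (degree P)" using less.prems by (auto simp: odd_poly_def)
    then obtain l where "degree P = 2 * l + 1" by (elim oddE)
    with False have m: "degree P = 2 * (l - 1) + 3" by simp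
    define m where "m = l - 1"
    note m = m[folded m_def]
    \<comment> \<open>The factor 32 matches \<open>coeff_red_poly\<close>, so the top coefficients
      cancel over the integers; it accounts for the exponent \<open>e + 5\<close> below.\<close>
    define Q where "Q = smult 32 P + smult (lead_coeff P) (red_poly m)"
    have "degree Q < degree P"
    proof -
      have "coeff Q i = 0" if "i \<ge> 2 * m + 3" for i
        using that degree_red_poly[of m] m
        by (cases "i = 2 * m + 3") (auto simp: Q_def coeff_red_poly coeff_eq_0)
      then have "degree Q \<le> 2 * m + 2" by (intro degree_le) auto
      then show ?thesis using m by simp
    qed
    moreover have "odd_poly Q"
      using less.prems odd_poly_red_poly[of m] by (simp add: odd_poly_def Q_def)
    ultimately obtain a e where
      ae: "[2 ^ e * apery_sum N Q = a * apery_sum N [:0, 1:]] (mod int N ^ 3)" for N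
      using less.hyps by blast
    have "[2 ^ (e + 5) * apery_sum N P = a * apery_sum N [:0, 1:]] (mod int N ^ 3)" for N
    proof -
      have "2 ^ (e + 5) * apery_sum N P
          = 2 ^ e * apery_sum N Q - 2 ^ e * lead_coeff P * apery_sum N (red_poly m)"
        by (simp add: Q_def apery_sum_add apery_sum_smult power_add algebra_simps)
      moreover have "[2 ^ e * lead_coeff P * apery_sum N (red_poly m) = 0] (mod int N ^ 3)"
        using apery_sum_red_poly[of N m] by (simp add: cong_0_iff)
      ultimately show ?thesis using cong_diff[OF ae] by fastforce
    qed
    then show ?thesis by blast
  qed
qed

section \<open>The first moment modulo \<open>p ^ 3\<close>\<close>

text \<open>Telescoping in \<open>N\<close>, since \<open>(N + 1 + j)\<^sup>2 - (N - j)\<^sup>2 = (2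
  * N + 1) * (2 * j + 1)\<close>.\<close>

lemma sum_apery_term:
  "(2 * int j + 1) * (\<Sum>k<N. (2 * int k + 1) * (apery_term k j)\<^sup>2)
    = ((int N - int j) * apery_term N j)\<^sup>2"
proof (induction N)
  case 0
  then show ?case by (cases j) (simp_all add: apery_term_def)
next
  case (Suc N)
  have "((int (Suc N) - int j) * apery_term (Suc N) j)\<^sup>2 = ((int N + 1 + int j) * apery_term N j)\<^sup>2"
    using apery_term_Suc_left[of N j] by (simp add: algebra_simps)
  then show ?case
    unfolding sum.lessThan_Suc distrib_left Suc.IH
    by (simp add: algebra_simps power2_eq_square)
qed

context
  fixes p :: nat
  assumes p: "prime p" "odd p"
begin

text \<open>Chosen so that the right-hand side of \<open>sum_apery_term\<close> at
  \<open>N = p\<close> is \<open>(p * mod_term j)\<^sup>2\<close>.\<close>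

definition mod_term :: "nat \<Rightarrow> int" where
  "mod_term j = int ((p - 1 choose j) * (p + j choose j))"

lemma mod_term: "(int p - int j) * apery_term p j = int p * mod_term j"
proof (cases "j \<le> p")
  case True
  have "(p - j) * (p choose j) = p * (p - 1 choose j)"
    using binomial_absorb_comp by blast
  then have "int (p - j) * int (p choose j) = int p * int (p - 1 choose j)"
    by (metis of_nat_mult)
  then show ?thesis
    using True by (simp add: apery_term_def mod_term_def of_nat_diff)
qed (simp add: apery_term_def mod_term_def binomial_eq_0)

text \<open>Multiplying by \<open>p\<close> gives access to the ratio of consecutive
  \<open>apery_term p j\<close>; \<open>p\<close> is cancelled at the end.\<close>

lemma mod_term_Suc:
  "(int j + 1)\<^sup>2 * mod_term (Suc j) = ((int p)\<^sup>2 - (int j + 1)\<^sup>2) * mod_term j"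
proof -
  have "int p * ((int j + 1)\<^sup>2 * mod_term (Suc j))
      = (int j + 1)\<^sup>2 * ((int p - int (Suc j)) * apery_term p (Suc j))"
    by (simp only: mod_term) (simp only: mult_ac)
  also have "\<dots> = (int p - int j - 1) * ((int j + 1)\<^sup>2 * apery_term p (Suc j))"
    by (simp add: algebra_simps)
  also have "\<dots> = (int p - int j - 1) * (int p + int j + 1) * ((int p - int j) * apery_term p j)"
    by (simp add: apery_term_Suc_right)
  also have "\<dots> = int p * (((int p)\<^sup>2 - (int j + 1)\<^sup>2) * mod_term j)"
    unfolding mod_term by (simp add: algebra_simps power2_eq_square)
  finally show ?thesis using p by (simp add: prime_gt_0_nat)
qed

text \<open>Modulo \<open>p\<^sup>2\<close>, cancelling the unit \<open>(j + 1)\<^sup>2\<close> in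
  \<open>mod_term_Suc\<close> shows that each step flips the sign; squaring removes it.\<close>

lemma mod_term_cong:
  assumes "j < p"
  shows "[(mod_term j)\<^sup>2 = 1] (mod (int p)\<^sup>2)"
proof -
  have "[mod_term j = (-1) ^ j] (mod (int p)\<^sup>2)"
    using assms
  proof (induction j)
    case (Suc j)
    have "[(int j + 1)\<^sup>2 * mod_term (Suc j) = (int j + 1)\<^sup>2 * (- mod_term j)] (mod (int p)\<^sup>2)"
      unfolding mod_term_Suc cong_iff_dvd_diff by (simp add: left_diff_distrib)
    moreover have "coprime (int j + 1) (int p)"
    proof -
      have "coprime (Suc j) p"
        using p(1) Suc.prems by (metis coprime_commute nat_dvd_not_less prime_imp_coprime_nat zero_less_Suc)
      then have "coprime (int (Suc j)) (int p)" by (simp only: coprime_int_iff)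
      then show ?thesis by (simp add: add.commute)
    qed
    ultimately have "[mod_term (Suc j) = - mod_term j] (mod (int p)\<^sup>2)"
      by (subst (asm) cong_mult_lcancel) auto
    moreover have "[- mod_term j = - ((-1) ^ j)] (mod (int p)\<^sup>2)"
      using Suc by (simp add: cong_minus_minus_iff)
    ultimately show ?case by (simp add: cong_trans)
  qed (simp add: mod_term_def)
  then have "[(mod_term j)\<^sup>2 = ((-1) ^ j)\<^sup>2] (mod (int p)\<^sup>2)" by (rule cong_pow)
  then show ?thesis by (simp flip: power_mult)
qed

definition col_sum :: "nat \<Rightarrow> int" where
  "col_sum j = (\<Sum>k<p. (2 * int k + 1) * (apery_term k j)\<^sup>2)"

lemma col_sum: "(2 * int j + 1) * col_sum j = (int p)\<^sup>2 * (mod_term j)\<^sup>2"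
  unfolding col_sum_def sum_apery_term by (simp add: mod_term power_mult_distrib)

text \<open>As \<open>2 * j + 1 < 2 * p\<close>, its only possible value divisible by
  \<open>p\<close> is \<open>p\<close> itself.\<close>

lemma coprime_odd_p:
  assumes "j < p" "2 * j + 1 \<noteq> p"
  shows "coprime (2 * int j + 1) (int p)"
proof -
  have "\<not> p dvd 2 * j + 1"
  proof
    assume "p dvd 2 * j + 1"
    then obtain q where q: "2 * j + 1 = p * q" by auto
    with assms have "p * q < p * 2" by linarith
    then have "q < 2" by simp
    then have "q = 0 \<or> q = 1" by auto
    with q assms show False by auto
  qed
  then have "coprime (2 * j + 1) p" using p
    by (metis coprime_commute prime_imp_coprime_nat)
  then have "coprime (int (2 * j + 1)) (int p)" by (simp only: coprime_int_iff)
  then show ?thesis by (simp add: add.commute)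
qed

text \<open>The units \<open>2 * j + 1\<close> and \<open>2 * i + 1\<close> add up to
  \<open>2 * p\<close>, so their reciprocals cancel modulo \<open>p\<close>; \<open>col_sum\<close>
  supplies the other factor \<open>p\<^sup>2\<close>.\<close>

lemma col_sum_pair:
  assumes j: "j < p" and i: "i + j = p - 1" and ne: "2 * j + 1 \<noteq> p"
  shows "int p ^ 3 dvd col_sum j + col_sum i"
proof -
  let ?J = "2 * int j + 1" and ?I = "2 * int i + 1"
  have p0: "p > 0" using p by (simp add: prime_gt_0_nat)
  have ilt: "i < p" "2 * i + 1 \<noteq> p" using i ne p0 by linarith+
  have IJ: "?J + ?I = 2 * int p" using i p0 by linarith
  have sq: "[(mod_term k)\<^sup>2 = 1] (mod int p)" if "k < p" for k
    using mod_term_cong[OF that] by (rule cong_dvd_modulus) simp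
  have "[?I * (mod_term j)\<^sup>2 + ?J * (mod_term i)\<^sup>2 = ?I * 1 + ?J * 1] (mod int p)"
    by (intro cong_add cong_mult cong_refl sq j ilt)
  moreover have "[?I * 1 + ?J * 1 = 0] (mod int p)"
    using IJ by (simp add: cong_0_iff add.commute)
  ultimately have "int p dvd ?I * (mod_term j)\<^sup>2 + ?J * (mod_term i)\<^sup>2"
    using cong_0_iff cong_trans by blast
  then have "(int p)\<^sup>2 * int p dvd (int p)\<^sup>2 * (?I * (mod_term j)\<^sup>2 + ?J * (mod_term i)\<^sup>2)"
    by (rule mult_dvd_mono[OF dvd_refl])
  moreover have "(?J * ?I) * (col_sum j + col_sum i)
      = (int p)\<^sup>2 * (?I * (mod_term j)\<^sup>2 + ?J * (mod_term i)\<^sup>2)"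
  proof -
    have "(?J * ?I) * (col_sum j + col_sum i) = ?I * (?J * col_sum j) + ?J * (?I * col_sum i)"
      by (simp add: algebra_simps)
    then show ?thesis by (simp only: col_sum) (simp add: algebra_simps)
  qed
  ultimately have "int p ^ 3 dvd (?J * ?I) * (col_sum j + col_sum i)"
    by (simp add: power3_eq_cube power2_eq_square)
  moreover have "coprime (int p ^ 3) (?J * ?I)"
    using coprime_odd_p[OF j ne] coprime_odd_p[OF ilt]
    by (simp add: coprime_commute)
  ultimately show ?thesis by (simp only: coprime_dvd_mult_right_iff)
qed

lemma apery_sum_linear: "[apery_sum p [:0, 1:] = int p] (mod int p ^ 3)"
proof -
  have p0: "p > 0" using p by (simp add: prime_gt_0_nat)
  obtain h where h: "p = 2 * h + 1" using p(2) by (elim oddE)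
  define A where "A = {..<p} - {h}"
  have "apery_sum p [:0, 1:] = (\<Sum>k<p. (2 * int k + 1) * (\<Sum>j<p. (apery_term k j)\<^sup>2))"
    unfolding apery_sum_def by (intro sum.cong) (auto simp: apery_conv_apery_term)
  also have "\<dots> = (\<Sum>k<p. \<Sum>j<p. (2 * int k + 1) * (apery_term k j)\<^sup>2)"
    by (simp only: sum_distrib_left)
  also have "\<dots> = (\<Sum>j<p. col_sum j)"
    unfolding col_sum_def by (rule sum.swap)
  also have "\<dots> = col_sum h + sum col_sum A"
    unfolding A_def using h by (subst sum.remove[of _ h]) auto
  finally have split: "apery_sum p [:0, 1:] = col_sum h + sum col_sum A" .
  \<comment> \<open>Reflection maps \<open>A\<close> to itself, so doubling the sum pairs the
    columns; 2 is a unit modulo \<open>p ^ 3\<close>.\<close>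
  have "(\<Sum>j\<in>A. col_sum (p - 1 - j)) = sum col_sum A"
    by (rule sum.reindex_bij_witness[of _ "\<lambda>j. p - 1 - j" "\<lambda>j. p - 1 - j"])
       (use h in \<open>auto simp: A_def\<close>)
  then have "2 * sum col_sum A = (\<Sum>j\<in>A. col_sum j + col_sum (p - 1 - j))"
    by (simp add: sum.distrib)
  moreover have "int p ^ 3 dvd \<dots>"
    by (rule dvd_sum, rule col_sum_pair) (use h in \<open>auto simp: A_def\<close>)
  ultimately have "int p ^ 3 dvd 2 * sum col_sum A" by simp
  moreover have "coprime (int p ^ 3) 2" using p(2) by simp
  ultimately have "int p ^ 3 dvd sum col_sum A" by (simp only: coprime_dvd_mult_right_iff)
  moreover have "int p ^ 3 dvd col_sum h - int p"
  proof -
    \<comment> \<open>As \<open>2 * h + 1 = p\<close>, one factor \<open>p\<close> cancels in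
      \<open>col_sum\<close>.\<close>
    have "int p * col_sum h = int p * (int p * (mod_term h)\<^sup>2)"
      using col_sum[of h] h by (simp add: power2_eq_square algebra_simps)
    then have "col_sum h - int p = int p * ((mod_term h)\<^sup>2 - 1)"
      using p0 by (simp add: algebra_simps)
    moreover have "(int p)\<^sup>2 dvd (mod_term h)\<^sup>2 - 1"
      using mod_term_cong[of h] h by (simp add: cong_iff_dvd_diff)
    ultimately show ?thesis by (simp add: power3_eq_cube power2_eq_square mult.assoc)
  qed
  ultimately show ?thesis
    unfolding split cong_iff_dvd_diff
    by (metis add_diff_eq add.commute dvd_add)
qed

end

section \<open>Transfer to the p-adic integers\<close>

text \<open>Inverses modulo \<open>p ^ n\<close> are unique, so the reduced ones form a coherent
  sequence.\<close>

lemma padic_inverse: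
  assumes "prime p" "coprime d (int p)"
  obtains e where "e \<in> carrier (padic_int_ring p)" "\<And>n. [d * e n = 1] (mod int p ^ n)"
proof -
  have p0: "p > 0" using assms(1) by (simp add: prime_gt_0_nat)
  have "\<forall>n. \<exists>x. [d * x = 1] (mod int p ^ n)"
    using assms(2) by (auto intro!: cong_solve_coprime_int)
  then obtain x where x: "[d * x n = 1] (mod int p ^ n)" for n by metis
  define e where "e n = x n mod int p ^ n" for n
  have e: "[d * e n = 1] (mod int p ^ n)" for n
    using x[of n] by (simp add: e_def cong_def mod_mult_right_eq)
  have "e (Suc n) mod int p ^ n = e n" for n
  proof -
    have "[d * e (Suc n) = 1] (mod int p ^ n)"
      by (rule cong_dvd_modulus[OF e[of "Suc n"]]) simp
    then have "[d * e (Suc n) = d * e n] (mod int p ^ n)"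
      using e[of n] by (meson cong_sym cong_trans)
    then have "[e (Suc n) = e n] (mod int p ^ n)"
      by (subst (asm) cong_mult_lcancel) (use assms(2) in auto)
    then show ?thesis by (simp add: cong_def e_def)
  qed
  then have "e \<in> carrier (padic_int_ring p)"
    using p0 by (auto simp: padic_int_ring_def e_def)
  with e show thesis using that by blast
qed

lemma padic_of_int_mult_closed:
  assumes "p > 0" "e \<in> carrier (padic_int_ring p)"
  shows "padic_of_int p a \<otimes>\<^bsub>padic_int_ring p\<^esub> e \<in> carrier (padic_int_ring p)"
  using cring.cring_simprules(5)[OF cring_padic_int_ring[OF assms(1)] padic_of_int_closed[OF assms(1)] assms(2)] .

text \<open>The unit \<open>b\<close> is divided out by multiplying with its p-adic inverse
  \<open>e\<close>.\<close>

lemma padic_cong_rat: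
  assumes p: "prime p" and b: "coprime b (int p)" and b0: "b \<noteq> 0"
    and cong: "[b * s = a * t] (mod int p ^ m)"
  shows "\<exists>x. padic_eq_rat p x (of_int a / of_int b) \<and>
    padic_cong p (padic_of_int p s) (x \<otimes>\<^bsub>padic_int_ring p\<^esub> padic_of_int p t) (int p ^ m)"
proof -
  have p0: "p > 0" using p by (simp add: prime_gt_0_nat)
  \<comment> \<open>\<open>a / b\<close> need not be reduced, while \<open>padic_eq_rat\<close>
    refers to the reduced fraction \<open>u / d\<close>; \<open>a * d = u * b\<close> links the
    two.\<close>
  obtain u d where q: "quotient_of (of_int a / of_int b) = (u, d)" by fastforce
  have d0: "d > 0" using q by (rule quotient_of_denom_pos)
  have "(of_int a / of_int b :: rat) = of_int u / of_int d"
    using q by (rule quotient_of_div)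
  then have "(of_int (a * d) :: rat) = of_int (u * b)"
    using b0 d0 by (simp add: field_simps)
  then have ad: "a * d = u * b" by (simp only: of_int_eq_iff)
  obtain e where e: "e \<in> carrier (padic_int_ring p)" "[b * e n = 1] (mod int p ^ n)" for n
    using padic_inverse[OF p b] by blast
  \<comment> \<open>The cofactor \<open>w\<close>, divided by \<open>b\<close>, becomes the witness
    required by \<open>padic_cong\<close>.\<close>
  obtain w where w: "b * s = a * t + int p ^ m * w"
    using cong by (metis cong_iff_lin cong_sym mult.commute)
  let ?x = "padic_of_int p a \<otimes>\<^bsub>padic_int_ring p\<^esub> e"
  let ?z = "padic_of_int p w \<otimes>\<^bsub>padic_int_ring p\<^esub> e"
  have "[d * (a * e n) = u] (mod int p ^ n)" for n
  proof -
    have "d * (a * e n) = (a * d) * e n" by simp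
    also have "\<dots> = u * (b * e n)" by (simp add: ad)
    finally show ?thesis using cong_scalar_left[OF e(2)[of n], of u] by (simp only: mult_1_right)
  qed
  then have "padic_eq_rat p ?x (of_int a / of_int b)"
    using padic_of_int_mult_closed[OF p0 e(1)]
    by (simp add: padic_eq_rat_def q padic_int_ring_def padic_of_int_def fun_eq_iff cong_def mod_simps)
  moreover have "[s = a * e n * t + int p ^ m * (w * e n)] (mod int p ^ n)" for n
  proof -
    have "s * (b * e n) = (b * s) * e n" by simp
    then have "a * e n * t + int p ^ m * (w * e n) = s * (b * e n)"
      by (simp add: w algebra_simps)
    then show ?thesis using cong_scalar_left[OF e(2)[of n], of s] by (simp add: cong_sym)
  qed
  then have "padic_cong p (padic_of_int p s) (?x \<otimes>\<^bsub>padic_int_ring p\<^esub> padic_of_int p t) (int p ^ m)"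
    unfolding padic_cong_def
    by (intro bexI[OF _ padic_of_int_mult_closed[OF p0 e(1), of w]])
       (simp add: padic_int_ring_def padic_of_int_def fun_eq_iff cong_def mod_simps)
  ultimately show ?thesis by blast
qed

theorem theorem3p2:
  shows "\<exists>c :: nat \<Rightarrow> rat. \<forall>p :: nat. prime p \<and> p > 3 \<longrightarrow>
    (\<forall>r :: nat. \<exists>x. padic_eq_rat p x (c r) \<and>
      padic_cong p
        (padic_of_int p (int (\<Sum>k = 0..p - 1. (2 * k + 1) ^ (2 * r + 1) * apery k)))
        (x \<otimes>\<^bsub>padic_int_ring p\<^esub> padic_of_int p (int p))
        (int p ^ 3))"
proof -
  have "\<forall>r. \<exists>a e. \<forall>N. [2 ^ e * apery_sum N (monom 1 (2 * r + 1)) = a * apery_sum N [:0, 1:]] (mod int N ^ 3)"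
    by (intro allI odd_poly_apery_sum) (auto simp: odd_poly_def)
  then obtain a e where
    ae: "[2 ^ e r * apery_sum N (monom 1 (2 * r + 1)) = a r * apery_sum N [:0, 1:]] (mod int N ^ 3)" for r N
    by metis
  \<comment> \<open>The constants are fixed before \<open>p\<close>; their denominators are powers
    of two, hence units for every odd prime.\<close>
  show ?thesis
  proof (intro exI[of _ "\<lambda>r. of_int (a r) / of_int (2 ^ e r)"] allI impI, elim conjE)
    fix p r :: nat
    assume p: "prime p" "p > 3"
    then have odd: "odd p" by (simp add: prime_odd_nat)
    have "{0..p - 1} = {..<p}" using p by auto
    then have sum: "int (\<Sum>k = 0..p - 1. (2 * k + 1) ^ (2 * r + 1) * apery k) = apery_sum p (monom 1 (2 * r + 1))"
      by (simp only: apery_sum_def poly_monom of_nat_sum of_nat_mult of_nat_power of_nat_add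
          of_nat_numeral of_nat_1 mult_1)
    have "[2 ^ e r * apery_sum p (monom 1 (2 * r + 1)) = a r * int p] (mod int p ^ 3)"
      using ae cong_scalar_left[OF apery_sum_linear[OF p(1) odd]] by (rule cong_trans)
    then show "\<exists>x. padic_eq_rat p x (of_int (a r) / of_int (2 ^ e r)) \<and>
      padic_cong p
        (padic_of_int p (int (\<Sum>k = 0..p - 1. (2 * k + 1) ^ (2 * r + 1) * apery k)))
        (x \<otimes>\<^bsub>padic_int_ring p\<^esub> padic_of_int p (int p)) (int p ^ 3)"
      unfolding sum by (intro padic_cong_rat p) (use odd in auto)
  qed
qed

end
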